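(* Let $\Omega=\prod_{k=1}^n\Omega_k$ with product probability measure $\mu=\bigotimes_{k=1}^n\mu_k$, and let $f$ be a bounded measurable real function on $\Omega$. Then for any $\beta>0$ one has the entropy bound $$S_f(\beta)\le E_{\beta f}\left[\sum_{k=1}^n\int_0^\beta\int_t^\beta\sigma_{k,sf}^2[f]\,\mathrm{d}s\,\mathrm{d}t\right],$$ the formula for the log-Laplace transform $$\ln E\bigl[\mathrm{e}^{\beta(f-E[f])}\bigr]=\beta\int_0^\beta\frac{S_f(\gamma)}{\gamma^2}\,\mathrm{d}\gamma ,$$ and, for every $t\ge0$, the concentration inequality $$\Pr\{f-E[f]>t\}\le\exp\left(\beta\int_0^\beta\frac{S_f(\gamma)}{\gamma^2}\,\mathrm{d}\gamma-\beta t\right).$$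
   Context: $E[g]=\int_\Omega g\,\mathrm{d}\mu$ and $\Pr$ is probability under $\mu$. For $\beta\in\mathbb{R}$: $E_{\beta f}[g]=E[g\,\mathrm{e}^{\beta f}]/E[\mathrm{e}^{\beta f}]$ is the thermal expectation, and $S_f(\beta)=\beta E_{\beta f}[f]-\ln E[\mathrm{e}^{\beta f}]$ is the canonical entropy. For $\mathbf{x}\in\Omega$ and $y\in\Omega_k$, $\mathbf{x}_{y,k}$ denotes $\mathbf{x}$ with its $k$th coordinate replaced by $y$. The conditional expectation operator is $E_k[g](\mathbf{x})=\int_{\Omega_k}g(\mathbf{x}_{y,k})\,\mathrm{d}\mu_k(y)$. The conditional thermal expectation is $E_{k,\beta f}[g]=E_k[g\,\mathrm{e}^{\beta f}]/E_k[\mathrm{e}^{\beta f}]$, and the conditional thermal variance is $\sigma_{k,\beta f}^2[g]=E_{k,\beta f}\bigl[(g-E_{k,\beta f}[g])^2\bigr]$; these are functions on $\Omega$ not depending on the $k$th coordinate. *)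

theory Defs
  imports "HOL-Probability.Probability"
begin

definition thermal_expectation :: "'w measure \<Rightarrow> real \<Rightarrow> ('w \<Rightarrow> real) \<Rightarrow> ('w \<Rightarrow> real) \<Rightarrow> real" where
  "thermal_expectation P \<beta> f g =
     (\<integral>x. g x * exp (\<beta> * f x) \<partial>P) / (\<integral>x. exp (\<beta> * f x) \<partial>P)"

definition canonical_entropy :: "'w measure \<Rightarrow> ('w \<Rightarrow> real) \<Rightarrow> real \<Rightarrow> real" where
  "canonical_entropy P f \<beta> =
     \<beta> * thermal_expectation P \<beta> f f - ln (\<integral>x. exp (\<beta> * f x) \<partial>P)"

text \<open>Points of the product space are functions on the index set, so replacing the
  \<open>k\<close>-th coordinate of \<open>x\<close> by \<open>y\<close> is the function update \<open>x(k := y)\<close>. These are pointwise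
  defined functions on the product space, not almost-everywhere classes.\<close>

definition coord_expectation ::
  "('i \<Rightarrow> 'a measure) \<Rightarrow> 'i \<Rightarrow> (('i \<Rightarrow> 'a) \<Rightarrow> real) \<Rightarrow> ('i \<Rightarrow> 'a) \<Rightarrow> real" where
  "coord_expectation M k g x = (\<integral>y. g (x(k := y)) \<partial>(M k))"

definition coord_thermal_expectation ::
  "('i \<Rightarrow> 'a measure) \<Rightarrow> 'i \<Rightarrow> real \<Rightarrow> (('i \<Rightarrow> 'a) \<Rightarrow> real) \<Rightarrow> (('i \<Rightarrow> 'a) \<Rightarrow> real) \<Rightarrow> ('i \<Rightarrow> 'a) \<Rightarrow> real"
  where
  "coord_thermal_expectation M k \<beta> f g x =
     coord_expectation M k (\<lambda>z. g z * exp (\<beta> * f z)) x /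
     coord_expectation M k (\<lambda>z. exp (\<beta> * f z)) x"

definition coord_thermal_variance ::
  "('i \<Rightarrow> 'a measure) \<Rightarrow> 'i \<Rightarrow> real \<Rightarrow> (('i \<Rightarrow> 'a) \<Rightarrow> real) \<Rightarrow> (('i \<Rightarrow> 'a) \<Rightarrow> real) \<Rightarrow> ('i \<Rightarrow> 'a) \<Rightarrow> real"
  where
  "coord_thermal_variance M k \<beta> f g =
     coord_thermal_expectation M k \<beta> f
       (\<lambda>z. (g z - coord_thermal_expectation M k \<beta> f g z)\<^sup>2)"

end

(* Writing L = ln E[exp (s f)], one has L' = E_sf[f] and L'' = the thermal variance, so integrating
   twice turns the double integral of the k-th conditional variance into the canonical entropy of
   f on the k-th fibre. The entropy bound is therefore subadditivity of entropy for
   g = exp (beta f): integrate out the coordinates one at a time, telescope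
   ln g - ln E[g] = sum_k (ln G_{k-1} - ln G_k), and bound each summand by the k-th conditional
   entropy via Gibbs' variational inequality. The log-Laplace formula is the fundamental theorem of
   calculus for L(s)/s, whose derivative is S_f(s)/s^2 and whose limit at 0 is E[f]. *)
theory Submission
  imports Defs
begin

section \<open>Derivatives of the partition function of a bounded random variable\<close>

lemma exp_remainder_bound:
  fixes u :: real
  shows "\<bar>exp u - 1 - u\<bar> \<le> u\<^sup>2 * exp \<bar>u\<bar>"
proof -
  have 1: "1 + u \<le> exp u" by (rule exp_ge_add_one_self)
  have "exp u * (1 + (- u)) \<le> exp u * exp (- u)"
    by (intro mult_left_mono exp_ge_add_one_self) auto
  then have 2: "exp u - 1 \<le> u * exp u" by (simp add: algebra_simps flip: exp_add)
  \<comment> \<open>By \<open>2\<close> the remainder is at most \<open>u * (exp u - 1)\<close>; for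
    either sign of \<open>u\<close> this product is at most
    \<open>u\<^sup>2 * exp \<bar>u\<bar>\<close>.\<close>
  show ?thesis
  proof (cases "u \<ge> 0")
    case True
    have "u * (exp u - 1) \<le> u * (u * exp u)" using True 2 by (rule mult_left_mono[rotated])
    with 1 2 True show ?thesis by (simp add: power2_eq_square algebra_simps)
  next
    case False
    have "u * u * 1 \<le> u * u * exp \<bar>u\<bar>"
      by (intro mult_left_mono) auto
    moreover have "(-u) * (1 - exp u) \<le> (-u) * (-u)"
      using False 1 by (intro mult_left_mono) linarith+
    ultimately show ?thesis using 1 2 by (simp add: power2_eq_square algebra_simps)
  qed
qed

text \<open>Interpreted twice: on the product space, and on each fibre \<open>M k\<close> with the
  section of \<open>f\<close> through a fixed point. The explicit \<open>C\<close> gives the uniform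
  estimates behind integrability and differentiation.\<close>

locale bounded_rv = prob_space P for P :: "'w measure" +
  fixes h :: "'w \<Rightarrow> real" and C :: real
  assumes measurable_h [measurable]: "h \<in> borel_measurable P"
    and abs_h_le: "\<And>x. x \<in> space P \<Longrightarrow> \<bar>h x\<bar> \<le> C"
begin

lemma C_nonneg: "0 \<le> C"
  using abs_h_le not_empty by fastforce

lemma integrable_bounded:
  fixes g :: "'w \<Rightarrow> real"
  assumes "g \<in> borel_measurable P" "\<And>x. x \<in> space P \<Longrightarrow> \<bar>g x\<bar> \<le> B"
  shows "integrable P g"
  using assms by (intro integrable_const_bound[where B = B]) auto

lemma exp_h_bounds:
  assumes "x \<in> space P"
  shows "exp (- (\<bar>s\<bar> * C)) \<le> exp (s * h x)" "exp (s * h x) \<le> exp (\<bar>s\<bar> * C)"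
proof -
  have "\<bar>s * h x\<bar> \<le> \<bar>s\<bar> * C"
    unfolding abs_mult by (intro mult_left_mono abs_h_le assms) auto
  then show "exp (- (\<bar>s\<bar> * C)) \<le> exp (s * h x)" "exp (s * h x) \<le> exp (\<bar>s\<bar> * C)" by auto
qed

lemma integrable_mult_exp:
  fixes g :: "'w \<Rightarrow> real"
  assumes [measurable]: "g \<in> borel_measurable P" and "\<And>x. x \<in> space P \<Longrightarrow> \<bar>g x\<bar> \<le> B"
  shows "integrable P (\<lambda>x. g x * exp (s * h x))"
proof (rule integrable_bounded[where B = "B * exp (\<bar>s\<bar> * C)"])
  fix x assume x: "x \<in> space P"
  show "\<bar>g x * exp (s * h x)\<bar> \<le> B * exp (\<bar>s\<bar> * C)"
    unfolding abs_mult using assms(2)[OF x] exp_h_bounds[OF x, of s]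
    by (intro mult_mono) auto
qed simp

lemma integrable_exp [simp]: "integrable P (\<lambda>x. exp (s * h x))"
  using integrable_mult_exp[of "\<lambda>_. 1" 1 s] by simp

lemma integrable_h [simp]: "integrable P h"
  by (rule integrable_bounded[OF _ abs_h_le]) auto

lemma integral_exp_pos: "0 < (\<integral>x. exp (s * h x) \<partial>P)"
proof -
  have "exp (- (\<bar>s\<bar> * C)) = (\<integral>x. exp (- (\<bar>s\<bar> * C)) \<partial>P)" by (simp add: prob_space)
  also have "\<dots> \<le> (\<integral>x. exp (s * h x) \<partial>P)"
    by (intro integral_mono exp_h_bounds) auto
  finally show ?thesis by (rule less_le_trans[rotated]) simp
qed

lemma abs_power_h_le:
  assumes "x \<in> space P"
  shows "\<bar>h x ^ j\<bar> \<le> C ^ j"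
  unfolding power_abs using abs_h_le[OF assms] by (intro power_mono) auto

text \<open>Differentiation under the integral sign by a second-order remainder that is uniform in
  \<open>x\<close>. The weight \<open>g\<close> allows the choices \<open>1\<close>,
  \<open>h\<close> and \<open>h\<^sup>2\<close>, which cover the partition function and the first
  two moments.\<close>

lemma DERIV_integral_mult_exp:
  fixes g :: "'w \<Rightarrow> real"
  assumes g [measurable]: "g \<in> borel_measurable P" and B: "\<And>x. x \<in> space P \<Longrightarrow> \<bar>g x\<bar> \<le> B"
  shows "((\<lambda>s. \<integral>x. g x * exp (s * h x) \<partial>P) has_real_derivative
           (\<integral>x. g x * h x * exp (s * h x) \<partial>P)) (at s)"
proof -
  \<comment> \<open>\<open>B * exp (\<bar>s\<bar> * C)\<close> bounds the factor
    \<open>g x * exp (s * h x)\<close>; \<open>C\<^sup>2 * exp C\<close> comes from the remainder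
    bound at \<open>u = d * h x\<close>, where \<open>\<bar>u\<bar> \<le> C\<close> because
    \<open>\<bar>d\<bar> \<le> 1\<close>.\<close>
  define K where "K = B * exp (\<bar>s\<bar> * C) * (C\<^sup>2 * exp C)"
  let ?F = "\<lambda>s. \<integral>x. g x * exp (s * h x) \<partial>P"
  let ?D = "\<integral>x. g x * h x * exp (s * h x) \<partial>P"
  have gh: "\<bar>g x * h x\<bar> \<le> B * C" if "x \<in> space P" for x
    unfolding abs_mult using B[OF that] abs_h_le[OF that] by (intro mult_mono) auto
  note int = integrable_mult_exp[OF g B] integrable_mult_exp[of "\<lambda>x. g x * h x", OF _ gh]
  have bound: "\<bar>?F (s + d) - ?F s - d * ?D\<bar> \<le> K * d\<^sup>2" if d: "\<bar>d\<bar> \<le> 1" for d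
  proof -
    have eq: "?F (s + d) - ?F s - d * ?D =
        (\<integral>x. g x * exp ((s + d) * h x) - g x * exp (s * h x) - d * (g x * h x * exp (s * h x)) \<partial>P)"
      using int by simp
    also have "\<bar>\<dots>\<bar> \<le> (\<integral>x. K * d\<^sup>2 \<partial>P)"
    proof (rule integral_abs_bound[THEN order_trans], rule integral_mono)
      fix x assume x: "x \<in> space P"
      have dh: "\<bar>d * h x\<bar> \<le> C"
        using mult_mono[OF d abs_h_le[OF x]] by (simp add: abs_mult)
      have hC: "(h x)\<^sup>2 \<le> C\<^sup>2" using abs_power_h_le[OF x, of 2] by simp
      have "\<bar>exp (d * h x) - 1 - d * h x\<bar> \<le> (d * h x)\<^sup>2 * exp \<bar>d * h x\<bar>"
        by (rule exp_remainder_bound)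
      also have "\<dots> \<le> (d\<^sup>2 * C\<^sup>2) * exp C"
        using dh hC by (intro mult_mono) (auto simp: power_mult_distrib mult_left_mono)
      finally have r: "\<bar>exp (d * h x) - 1 - d * h x\<bar> \<le> d\<^sup>2 * C\<^sup>2 * exp C" .
      have "g x * exp ((s + d) * h x) - g x * exp (s * h x) - d * (g x * h x * exp (s * h x))
          = g x * exp (s * h x) * (exp (d * h x) - 1 - d * h x)"
        by (simp add: distrib_right exp_add algebra_simps)
      then have "\<bar>g x * exp ((s + d) * h x) - g x * exp (s * h x) - d * (g x * h x * exp (s * h x))\<bar>
          = \<bar>g x\<bar> * exp (s * h x) * \<bar>exp (d * h x) - 1 - d * h x\<bar>"
        by (simp only: abs_mult abs_exp_cancel)
      also have "\<dots> \<le> B * exp (\<bar>s\<bar> * C) * (d\<^sup>2 * C\<^sup>2 * exp C)"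
        using B[OF x] exp_h_bounds[OF x, of s] by (intro mult_mono r) auto
      also have "\<dots> = K * d\<^sup>2" by (simp add: K_def)
      finally show "\<bar>g x * exp ((s + d) * h x) - g x * exp (s * h x) - d * (g x * h x * exp (s * h x))\<bar> \<le> K * d\<^sup>2" .
    qed (use int in auto)
    finally show ?thesis by (simp add: prob_space)
  qed
  have "((\<lambda>d. (?F (s + d) - ?F s) / d - ?D) \<longlongrightarrow> 0) (at 0)"
  proof (rule Lim_null_comparison)
    have "\<forall>\<^sub>F d :: real in at 0. \<bar>d\<bar> \<le> 1 \<and> d \<noteq> 0"
      unfolding eventually_at by (intro exI[of _ 1]) auto
    then show "\<forall>\<^sub>F d in at 0. norm ((?F (s + d) - ?F s) / d - ?D) \<le> K * \<bar>d\<bar>"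
    proof eventually_elim
      case (elim d)
      have "norm ((?F (s + d) - ?F s) / d - ?D) = \<bar>?F (s + d) - ?F s - d * ?D\<bar> / \<bar>d\<bar>"
        using elim by (simp add: field_simps flip: abs_divide)
      also have "\<dots> \<le> K * d\<^sup>2 / \<bar>d\<bar>"
        using bound[of d] elim by (intro divide_right_mono) auto
      also have "\<dots> = K * \<bar>d\<bar>" using elim by (simp add: power2_eq_square field_simps)
      finally show ?case .
    qed
    show "((\<lambda>d. K * \<bar>d\<bar>) \<longlongrightarrow> 0) (at 0)" by (auto intro!: tendsto_eq_intros)
  qed
  then show ?thesis unfolding DERIV_def by (subst (asm) LIM_zero_iff)
qed

abbreviation partition_function :: "real \<Rightarrow> real" where
  "partition_function s \<equiv> \<integral>x. exp (s * h x) \<partial>P"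

abbreviation thermal_variance :: "real \<Rightarrow> real" where
  "thermal_variance s \<equiv> thermal_expectation P s h (\<lambda>x. (h x - thermal_expectation P s h h)\<^sup>2)"

lemma DERIV_partition:
  "(partition_function has_real_derivative (\<integral>x. h x * exp (s * h x) \<partial>P)) (at s)"
  using DERIV_integral_mult_exp[of "\<lambda>_. 1" 1 s] by simp

lemma DERIV_first_moment:
  "((\<lambda>s. \<integral>x. h x * exp (s * h x) \<partial>P) has_real_derivative (\<integral>x. (h x)\<^sup>2 * exp (s * h x) \<partial>P)) (at s)"
  using DERIV_integral_mult_exp[OF measurable_h abs_h_le, of s] by (simp add: power2_eq_square)

text \<open>Expanding the square leaves a rational expression in the moments. This is the form that
  the quotient rule produces for the derivative of the thermal mean, and its continuity in
  \<open>s\<close> follows from that of the moments.\<close>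

lemma thermal_variance_eq:
  "thermal_variance s = (\<integral>x. (h x)\<^sup>2 * exp (s * h x) \<partial>P) / partition_function s
     - ((\<integral>x. h x * exp (s * h x) \<partial>P) / partition_function s)\<^sup>2"
proof -
  define m where "m = thermal_expectation P s h h"
  have i2: "integrable P (\<lambda>x. (h x)\<^sup>2 * exp (s * h x))"
    by (rule integrable_mult_exp[where B = "C^2"]) (use abs_power_h_le[of _ 2] in auto)
  have i1: "integrable P (\<lambda>x. h x * exp (s * h x))"
    by (rule integrable_mult_exp[OF _ abs_h_le]) auto
  have "(\<integral>x. (h x - m)\<^sup>2 * exp (s * h x) \<partial>P)
      = (\<integral>x. (h x)\<^sup>2 * exp (s * h x) - 2 * m * (h x * exp (s * h x)) + m\<^sup>2 * exp (s * h x) \<partial>P)"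
    by (intro Bochner_Integration.integral_cong) (auto simp: power2_eq_square algebra_simps)
  also have "\<dots> = (\<integral>x. (h x)\<^sup>2 * exp (s * h x) \<partial>P) - 2 * m * (\<integral>x. h x * exp (s * h x) \<partial>P)
      + m\<^sup>2 * partition_function s"
    using i1 i2 by simp
  finally show ?thesis
    using integral_exp_pos[of s] unfolding m_def thermal_expectation_def
    by (simp add: field_simps power2_eq_square)
qed

lemma DERIV_ln_partition:
  "((\<lambda>s. ln (partition_function s)) has_real_derivative thermal_expectation P s h h) (at s)"
  unfolding thermal_expectation_def
  by (rule derivative_eq_intros DERIV_partition integral_exp_pos refl)+ simp

lemma DERIV_thermal_expectation:
  "((\<lambda>s. thermal_expectation P s h h) has_real_derivative thermal_variance s) (at s)"
  unfolding thermal_variance_eq unfolding thermal_expectation_def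
  using integral_exp_pos[of s]
  by (auto intro!: derivative_eq_intros DERIV_partition DERIV_first_moment
      simp: field_simps power2_eq_square)

lemma isCont_thermal_variance: "isCont thermal_variance s"
proof -
  have "isCont (\<lambda>s. \<integral>x. (h x)\<^sup>2 * exp (s * h x) \<partial>P) s"
    by (rule DERIV_isCont[OF DERIV_integral_mult_exp[where B = "C^2"]])
      (use abs_power_h_le[of _ 2] in auto)
  then show ?thesis
    unfolding thermal_variance_eq
    using integral_exp_pos[of s] DERIV_isCont[OF DERIV_partition] DERIV_isCont[OF DERIV_first_moment]
    by (intro continuous_intros) auto
qed

lemma entropy_eq_double_integral:
  assumes "0 < b"
  shows "(LBINT t=0..b. (LBINT s=t..b. thermal_variance s)) = canonical_entropy P h b"
proof -
  let ?m = "\<lambda>s. thermal_expectation P s h h"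
  have inner: "(LBINT s=t..b. thermal_variance s) = ?m b - ?m t" for t
    by (rule interval_integral_FTC_finite)
      (auto intro!: continuous_at_imp_continuous_on isCont_thermal_variance
        DERIV_thermal_expectation[THEN DERIV_subset]
        simp flip: has_real_derivative_iff_has_vector_derivative)
  \<comment> \<open>\<open>?m b\<close> is constant in \<open>t\<close>, and \<open>?m t\<close> is
    the derivative of the log-partition function. At \<open>t = b\<close> this antiderivative is the
    canonical entropy; at \<open>t = 0\<close> it vanishes because the partition function is 1
    there.\<close>
  have "((\<lambda>t. t * ?m b - ln (partition_function t)) has_real_derivative ?m b - ?m t) (at t)" for t
    by (rule derivative_eq_intros DERIV_ln_partition refl)+ simp
  note deriv = this
  have "(LBINT t=ereal 0..ereal b. ?m b - ?m t) = (b * ?m b - ln (partition_function b))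
      - (0 * ?m b - ln (partition_function 0))"
  proof (rule interval_integral_FTC_finite)
    show "continuous_on {min 0 b..max 0 b} (\<lambda>t. ?m b - ?m t)"
      by (intro continuous_at_imp_continuous_on ballI continuous_diff continuous_const
          DERIV_isCont[OF DERIV_thermal_expectation])
    show "((\<lambda>t. t * ?m b - ln (partition_function t)) has_vector_derivative ?m b - ?m t)
        (at t within {min 0 b..max 0 b})" for t
      using deriv[of t] unfolding has_real_derivative_iff_has_vector_derivative
      by (rule has_vector_derivative_at_within)
  qed
  then show ?thesis
    unfolding inner canonical_entropy_def by (simp add: prob_space zero_ereal_def)
qed

end

section \<open>Gibbs' variational inequality\<close>

lemma abs_ln_le:
  fixes a b y :: real
  assumes "0 < a" "a \<le> y \<and> y \<le> b"
  shows "\<bar>ln y\<bar> \<le> \<bar>ln a\<bar> + \<bar>ln b\<bar>"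
proof -
  have "ln a \<le> ln y" "ln y \<le> ln b" using assms by auto
  then show ?thesis by linarith
qed

text \<open>Up to the factor \<open>G\<close>, the difference of the two sides is the relative
  entropy of the density \<open>g / G\<close> with respect to \<open>u / U\<close>. The two-sided
  bounds keep the logarithms bounded, hence every term integrable.\<close>

lemma (in prob_space) entropy_variational:
  fixes g u :: "'a \<Rightarrow> real"
  assumes [measurable]: "g \<in> borel_measurable M" "u \<in> borel_measurable M"
    and "0 < a"
    and g: "\<And>x. x \<in> space M \<Longrightarrow> a \<le> g x \<and> g x \<le> b"
    and u: "\<And>x. x \<in> space M \<Longrightarrow> a \<le> u x \<and> u x \<le> b"
  shows "(\<integral>x. g x * (ln (u x) - ln (\<integral>x. u x \<partial>M)) \<partial>M)
    \<le> (\<integral>x. g x * ln (g x) \<partial>M) - (\<integral>x. g x \<partial>M) * ln (\<integral>x. g x \<partial>M)"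
proof -
  define G where "G = (\<integral>x. g x \<partial>M)"
  define U where "U = (\<integral>x. u x \<partial>M)"
  have bdd: "integrable M w" if "w \<in> borel_measurable M" "\<And>x. x \<in> space M \<Longrightarrow> \<bar>w x\<bar> \<le> B" for w :: "'a \<Rightarrow> real" and B
    using that by (intro integrable_const_bound[where B = B]) auto
  have "\<bar>g x\<bar> \<le> b" "\<bar>u x\<bar> \<le> b" if "x \<in> space M" for x
    using g[OF that] u[OF that] \<open>0 < a\<close> by linarith+
  note bd = this
  have ig: "integrable M g" by (rule bdd[OF _ bd(1)]) auto
  have iu: "integrable M u" by (rule bdd[OF _ bd(2)]) auto
  have prod_bd: "\<bar>g x * ln y\<bar> \<le> b * (\<bar>ln a\<bar> + \<bar>ln b\<bar>)" if "x \<in> space M" "a \<le> y \<and> y \<le> b" for x y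
    unfolding abs_mult using g[OF that(1)] \<open>0 < a\<close> abs_ln_le[OF \<open>0 < a\<close> that(2)] by (intro mult_mono) auto
  have igg: "integrable M (\<lambda>x. g x * ln (g x))" by (rule bdd[OF _ prod_bd[OF _ g]]) auto
  have igu: "integrable M (\<lambda>x. g x * ln (u x))" by (rule bdd[OF _ prod_bd[OF _ u]]) auto
  have "(\<integral>x. a \<partial>M) \<le> G" "(\<integral>x. a \<partial>M) \<le> U"
    unfolding G_def U_def by (rule integral_mono; simp add: ig iu g u)+
  then have pos: "0 < G" "0 < U" using \<open>0 < a\<close> by (auto simp: prob_space)
  have "(\<integral>x. g x * (ln (u x) - ln U) - g x * ln (g x) + g x * ln G \<partial>M) \<le> (\<integral>x. u x * (G / U) - g x \<partial>M)"
  proof (rule integral_mono)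
    fix x assume x: "x \<in> space M"
    have gx: "0 < g x" and ux: "0 < u x" using g[OF x] u[OF x] \<open>0 < a\<close> by auto
    \<comment> \<open>\<open>ln r \<le> r - 1\<close> at the ratio of the densities
      \<open>u / U\<close> and \<open>g / G\<close>. After multiplication by \<open>g x\<close> the
      right side integrates to \<open>U * (G / U) - G = 0\<close>.\<close>
    have "ln (u x * G / (g x * U)) \<le> u x * G / (g x * U) - 1"
      using gx ux pos by (intro ln_le_minus_one) auto
    then have "g x * (ln (u x) + ln G - ln (g x) - ln U) \<le> g x * (u x * G / (g x * U) - 1)"
      using gx ux pos by (intro mult_left_mono) (auto simp: ln_div ln_mult)
    also have "\<dots> = u x * (G / U) - g x" using gx ux pos by (simp add: field_simps)
    finally show "g x * (ln (u x) - ln U) - g x * ln (g x) + g x * ln G \<le> u x * (G / U) - g x"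
      by (simp add: algebra_simps)
  qed (use ig iu igg igu in \<open>auto simp: right_diff_distrib\<close>)
  also have "\<dots> = 0" using ig iu pos by (simp add: G_def U_def)
  finally have "(\<integral>x. g x * (ln (u x) - ln U) - g x * ln (g x) + g x * ln G \<partial>M) \<le> 0" .
  moreover have "integrable M (\<lambda>x. g x * (ln (u x) - ln U))"
    using igu ig by (simp add: right_diff_distrib)
  ultimately show ?thesis
    unfolding G_def[symmetric] U_def[symmetric] using ig igg by (simp add: G_def)
qed

section \<open>Log-Laplace transform and exponential Markov inequality\<close>

context bounded_rv begin

text \<open>Clearing the denominator identifies the canonical entropy with the functional entropy of
  \<open>exp (s * h x)\<close>, the form to which the variational inequality applies.\<close>

lemma canonical_entropy_eq:
  "canonical_entropy P h s * partition_function s =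
    (\<integral>x. exp (s * h x) * ln (exp (s * h x)) \<partial>P) - partition_function s * ln (partition_function s)"
proof -
  have "(\<integral>x. exp (s * h x) * ln (exp (s * h x)) \<partial>P) = (\<integral>x. s * (h x * exp (s * h x)) \<partial>P)"
    by (simp add: mult_ac)
  then show ?thesis
    using integral_exp_pos[of s]
    by (simp add: canonical_entropy_def thermal_expectation_def field_simps)
qed

text \<open>The trial function \<open>u = 1\<close> makes the left side of the variational
  inequality vanish. The sign is used to evaluate an integral that is improper at 0.\<close>

lemma canonical_entropy_nonneg: "0 \<le> canonical_entropy P h s"
proof -
  have "0 \<le> (\<integral>x. exp (s * h x) * ln (exp (s * h x)) \<partial>P) - partition_function s * ln (partition_function s)"
    \<comment> \<open>\<open>C_nonneg\<close> places the constant 1 between the two exponential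
      bounds.\<close>
    using entropy_variational[of "\<lambda>x. exp (s * h x)" "\<lambda>_. 1" "exp (- (\<bar>s\<bar> * C))" "exp (\<bar>s\<bar> * C)"]
      exp_h_bounds[of _ s] C_nonneg by (simp add: prob_space)
  then show ?thesis
    unfolding canonical_entropy_eq[symmetric] using integral_exp_pos[of s]
    by (simp add: zero_le_mult_iff)
qed

lemma DERIV_ln_partition_div:
  assumes "0 < s"
  shows "((\<lambda>s. ln (partition_function s) / s) has_real_derivative canonical_entropy P h s / s\<^sup>2) (at s)"
proof -
  have "(thermal_expectation P s h h * s - ln (partition_function s) * 1) / (s * s)
      = canonical_entropy P h s / s\<^sup>2"
    by (simp only: canonical_entropy_def power2_eq_square mult_1_right mult.commute[of s "thermal_expectation P s h h"])
  then show ?thesis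
    using DERIV_divide[OF DERIV_ln_partition[of s] DERIV_ident] assms by (metis less_irrefl)
qed

lemma isCont_canonical_entropy: "isCont (canonical_entropy P h) s"
  unfolding canonical_entropy_def
  by (intro continuous_diff continuous_mult continuous_ident
      DERIV_isCont[OF DERIV_thermal_expectation] DERIV_isCont[OF DERIV_ln_partition])

lemma log_laplace_transform:
  assumes "0 < b"
  shows "ln (\<integral>x. exp (b * (h x - (\<integral>z. h z \<partial>P))) \<partial>P)
    = b * (LBINT s=0..b. canonical_entropy P h s / s\<^sup>2)"
proof -
  let ?L = "\<lambda>s. ln (partition_function s)"
  \<comment> \<open>Since \<open>?L 0 = 0\<close>, this is the difference quotient of
    \<open>?L\<close> at 0; the derivative there is the thermal mean at \<open>s = 0\<close>, which
    is the ordinary mean.\<close>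
  have "((\<lambda>s. ?L s / s) \<longlongrightarrow> (\<integral>x. h x \<partial>P)) (at 0)"
    using DERIV_ln_partition[of 0] unfolding DERIV_def by (simp add: thermal_expectation_def prob_space)
  then have lim0: "((\<lambda>s. ?L s / s) \<longlongrightarrow> (\<integral>x. h x \<partial>P)) (at_right 0)"
    by (rule tendsto_mono[rotated]) (simp add: at_le)
  have limb: "((\<lambda>s. ?L s / s) \<longlongrightarrow> ?L b / b) (at_left b)"
    using DERIV_isCont[OF DERIV_ln_partition_div[OF assms]]
    unfolding isCont_def by (rule tendsto_mono[rotated]) (simp add: at_le)
  \<comment> \<open>The integrand degenerates at 0, so the integral is treated as improper: for a
    nonnegative integrand, one-sided limits of the antiderivative at the endpoints suffice.\<close>
  have "(LBINT s=ereal 0..ereal b. canonical_entropy P h s / s\<^sup>2) = ?L b / b - (\<integral>x. h x \<partial>P)"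
  proof (rule interval_integral_FTC_nonneg(2))
    show "((\<lambda>s. ?L s / s) has_real_derivative canonical_entropy P h s / s\<^sup>2) (at s)"
      if "ereal 0 < ereal s" for s using that DERIV_ln_partition_div by simp
    show "isCont (\<lambda>s. canonical_entropy P h s / s\<^sup>2) s" if "ereal 0 < ereal s" for s
      using that isCont_canonical_entropy by (intro continuous_intros) auto
    show "(((\<lambda>s. ?L s / s) \<circ> real_of_ereal) \<longlongrightarrow> (\<integral>x. h x \<partial>P)) (at_right (ereal 0))"
      using lim0 by (simp only: ereal_tendsto_simps)
    show "(((\<lambda>s. ?L s / s) \<circ> real_of_ereal) \<longlongrightarrow> ?L b / b) (at_left (ereal b))"
      using limb by (simp only: ereal_tendsto_simps)
  qed (use assms canonical_entropy_nonneg in auto)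
  \<comment> \<open>Centering only contributes a constant factor, so the logarithm is
    \<open>?L b\<close> minus \<open>b\<close> times the mean, which is \<open>b\<close> times the
    value just found.\<close>
  moreover have "(\<integral>x. exp (b * (h x - (\<integral>z. h z \<partial>P))) \<partial>P) = exp (- b * (\<integral>z. h z \<partial>P)) * partition_function b"
    by (simp add: right_diff_distrib exp_diff exp_minus field_simps)
  ultimately show ?thesis
    using assms integral_exp_pos[of b] by (simp add: ln_mult field_simps zero_ereal_def)
qed

lemma chernoff_bound:
  assumes "0 < b"
  shows "measure P {x \<in> space P. h x - (\<integral>z. h z \<partial>P) > t}
    \<le> exp (b * (LBINT s=0..b. canonical_entropy P h s / s\<^sup>2) - b * t)"
proof -
  let ?c = "\<lambda>x. h x - (\<integral>z. h z \<partial>P)"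
  have exp_eq: "exp (b * ?c x) = exp (- b * (\<integral>z. h z \<partial>P)) * exp (b * h x)" for x
    by (simp add: algebra_simps flip: exp_add)
  have int: "integrable P (\<lambda>x. exp (b * ?c x))" unfolding exp_eq by simp
  have pos: "0 < (\<integral>x. exp (b * ?c x) \<partial>P)" unfolding exp_eq using integral_exp_pos[of b] by simp
  have "measure P {x \<in> space P. ?c x > t} \<le> measure P {x \<in> space P. ?c x \<ge> t}"
    by (intro finite_measure_mono) auto
  also have "\<dots> \<le> exp (- b * t) * (\<integral>x\<in>space P. exp (b * ?c x) \<partial>P)"
    using assms int by (intro Chernoff_ineq_ge) (auto simp: set_integrable_def cong: Bochner_Integration.integrable_cong)
  also have "(\<integral>x\<in>space P. exp (b * ?c x) \<partial>P) = (\<integral>x. exp (b * ?c x) \<partial>P)"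
    by (rule set_integral_space[OF int])
  \<comment> \<open>The logarithm is introduced so that the log-Laplace formula can be
    substituted.\<close>
  also have "\<dots> = exp (ln \<dots>)" using pos by simp
  finally show ?thesis
    unfolding log_laplace_transform[OF assms] by (simp add: algebra_simps flip: exp_add)
qed

end

section \<open>Integrating out the coordinates one at a time\<close>

text \<open>Stage \<open>k\<close> is the conditional expectation of \<open>g\<close> given the
  coordinates after \<open>k\<close>, kept as a function of the full point so that all stages share
  one domain. Coordinates are numbered from 1, hence the \<open>Suc k\<close> in the
  recursion.\<close>

primrec iterated_expectation ::
  "(nat \<Rightarrow> 'a measure) \<Rightarrow> ((nat \<Rightarrow> 'a) \<Rightarrow> real) \<Rightarrow> nat \<Rightarrow> (nat \<Rightarrow> 'a) \<Rightarrow> real" where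
  "iterated_expectation M g 0 = g"
| "iterated_expectation M g (Suc k) = coord_expectation M (Suc k) (iterated_expectation M g k)"

lemma coord_expectation_upd_same: "coord_expectation M k u (x(k := y)) = coord_expectation M k u x"
  by (simp add: coord_expectation_def)

text \<open>Either \<open>j\<close> is the coordinate integrated last, and its value is overwritten,
  or its update commutes with the one at \<open>Suc k\<close> and the induction hypothesis
  applies.\<close>

lemma iterated_expectation_upd:
  assumes "1 \<le> j" "j \<le> k"
  shows "iterated_expectation M g k (x(j := y)) = iterated_expectation M g k x"
  using assms(2)
proof (induction k arbitrary: x)
  case (Suc k)
  show ?case
  proof (cases "j = Suc k")
    case False
    then have jk: "j \<le> k" and twist: "x(j := y, Suc k := z) = x(Suc k := z, j := y)" for z
      using Suc.prems fun_upd_twist[OF False, of x y z] by auto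
    have "iterated_expectation M g k (x(j := y, Suc k := z)) =
        iterated_expectation M g k (x(Suc k := z))" for z
      by (simp only: twist Suc.IH[OF jk])
    then show ?thesis by (simp only: iterated_expectation.simps coord_expectation_def)
  qed (simp only: iterated_expectation.simps coord_expectation_upd_same)
qed (use assms(1) in simp)

lemma iterated_expectation_cong:
  assumes "\<And>j. j \<notin> {1..k} \<Longrightarrow> x j = y j"
  shows "iterated_expectation M g k x = iterated_expectation M g k y"
proof -
  \<comment> \<open>Hybrid points: the first \<open>m\<close> coordinates are taken from
    \<open>y\<close>, the others from \<open>x\<close>. Passing from \<open>m\<close> to
    \<open>Suc m\<close> changes one integrated coordinate, and the hybrid for \<open>m = k\<close>
    is \<open>y\<close>.\<close>
  have "iterated_expectation M g k (\<lambda>j. if j \<in> {1..m} then y j else x j) = iterated_expectation M g k x"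
    if "m \<le> k" for m
    using that
  proof (induction m)
    case (Suc m)
    have "(\<lambda>j. if j \<in> {1..Suc m} then y j else x j)
        = (\<lambda>j. if j \<in> {1..m} then y j else x j)(Suc m := y (Suc m))"
      by auto
    with Suc show ?case by (simp only: iterated_expectation_upd)
  qed simp
  from this[of k] show ?thesis using assms by (simp cong: if_cong)
qed

section \<open>Conditional expectation over one coordinate\<close>

context product_prob_space
begin

lemma fun_upd_in_space_PiM:
  assumes "x \<in> space (PiM I M)" "k \<in> I" "y \<in> space (M k)"
  shows "x(k := y) \<in> space (PiM I M)"
  using assms by (auto simp: space_PiM PiE_iff extensional_def)

text \<open>For \<open>k\<close> already in \<open>I\<close>, adding a dimension is overwriting a
  coordinate, since \<open>insert k I = I\<close>.\<close>

lemma measurable_fun_upd_PiM: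
  assumes "k \<in> I"
  shows "(\<lambda>(x, y). x(k := y)) \<in> measurable (PiM I M \<Otimes>\<^sub>M M k) (PiM I M)"
  using measurable_add_dim[of k I M] assms by (simp add: insert_absorb)

lemma measurable_section:
  assumes "u \<in> borel_measurable (PiM I M)" "k \<in> I" "x \<in> space (PiM I M)"
  shows "(\<lambda>y. u (x(k := y))) \<in> borel_measurable (M k)"
  using measurable_compose[OF measurable_compose[OF measurable_Pair1'[OF assms(3)]
        measurable_fun_upd_PiM[OF assms(2)]] assms(1)] by simp

lemma measurable_coord_expectation:
  fixes u :: "('i \<Rightarrow> 'a) \<Rightarrow> real"
  assumes "u \<in> borel_measurable (PiM I M)" "k \<in> I"
  shows "coord_expectation M k u \<in> borel_measurable (PiM I M)"
proof -
  have "(\<lambda>(x, y). u (x(k := y))) \<in> borel_measurable (PiM I M \<Otimes>\<^sub>M M k)"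
    using measurable_compose[OF measurable_fun_upd_PiM[OF assms(2)] assms(1)]
    by (simp add: case_prod_unfold)
  then show ?thesis
    unfolding coord_expectation_def[abs_def] by (rule M.borel_measurable_lebesgue_integral)
qed

lemma coord_expectation_bounds:
  fixes u :: "('i \<Rightarrow> 'a) \<Rightarrow> real"
  assumes u: "u \<in> borel_measurable (PiM I M)" and bd: "\<And>x. x \<in> space (PiM I M) \<Longrightarrow> a \<le> u x \<and> u x \<le> b"
    and k: "k \<in> I" and x: "x \<in> space (PiM I M)"
  shows "a \<le> coord_expectation M k u x \<and> coord_expectation M k u x \<le> b"
proof -
  have sec: "a \<le> u (x(k := y)) \<and> u (x(k := y)) \<le> b" if "y \<in> space (M k)" for y
    using bd[OF fun_upd_in_space_PiM[OF x k that]] .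
  have "integrable (M k) (\<lambda>y. u (x(k := y)))"
    using sec by (intro M.integrable_const_bound[where B = "\<bar>a\<bar> + \<bar>b\<bar>"] measurable_section u k x AE_I2) force
  note int = this
  have "(\<integral>y. a \<partial>M k) \<le> coord_expectation M k u x" "coord_expectation M k u x \<le> (\<integral>y. b \<partial>M k)"
    unfolding coord_expectation_def by (rule integral_mono; simp add: sec int)+
  then show ?thesis by (simp add: M.prob_space)
qed

text \<open>Tower property. Fubini splits coordinate \<open>k\<close> off both integrals, and
  \<open>coord_expectation M k u\<close> is constant along that coordinate.\<close>

lemma integral_coord_expectation:
  fixes u :: "('i \<Rightarrow> 'a) \<Rightarrow> real"
  assumes "finite I" and k: "k \<in> I"
    and u: "u \<in> borel_measurable (PiM I M)" and bd: "\<And>x. x \<in> space (PiM I M) \<Longrightarrow> \<bar>u x\<bar> \<le> B"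
  shows "(\<integral>x. coord_expectation M k u x \<partial>PiM I M) = (\<integral>x. u x \<partial>PiM I M)"
proof -
  have I: "insert k (I - {k}) = I" using k by auto
  have fubini: "(\<integral>x. v x \<partial>PiM I M) = (\<integral>x. (\<integral>y. v (x(k := y)) \<partial>M k) \<partial>PiM (I - {k}) M)"
    if "v \<in> borel_measurable (PiM I M)" "\<And>x. x \<in> space (PiM I M) \<Longrightarrow> \<bar>v x\<bar> \<le> B" for v :: "('i \<Rightarrow> 'a) \<Rightarrow> real"
    using product_integral_insert[of "I - {k}" k v] P.integrable_const_bound[of v B] that \<open>finite I\<close>
    by (simp only: I finite_Diff) auto
  have bd': "\<bar>coord_expectation M k u x\<bar> \<le> B" if "x \<in> space (PiM I M)" for x
    using coord_expectation_bounds[OF u _ k that, of "- B" B] bd by (force simp: abs_le_iff)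
  have "(\<integral>x. coord_expectation M k u x \<partial>PiM I M)
      = (\<integral>x. (\<integral>y. coord_expectation M k u (x(k := y)) \<partial>M k) \<partial>PiM (I - {k}) M)"
    by (rule fubini[OF measurable_coord_expectation[OF u k] bd'])
  \<comment> \<open>Points of this smaller product are \<open>undefined\<close> at \<open>k\<close>;
    this is harmless because \<open>coord_expectation\<close> overwrites that value.\<close>
  also have "\<dots> = (\<integral>x. coord_expectation M k u x \<partial>PiM (I - {k}) M)"
    by (simp add: coord_expectation_upd_same M.prob_space)
  also have "\<dots> = (\<integral>x. u x \<partial>PiM I M)"
    unfolding coord_expectation_def by (rule fubini[OF u bd, symmetric])
  finally show ?thesis .
qed

end

section \<open>Subadditivity of entropy\<close>

text \<open>The entropy of \<open>g\<close> on the \<open>k\<close>-th fibre, divided by its mean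
  there. With this normalization \<open>g = exp (s * f)\<close> gives the canonical entropy of
  \<open>f\<close> on the fibre.\<close>

definition coord_entropy ::
  "('i \<Rightarrow> 'a measure) \<Rightarrow> 'i \<Rightarrow> (('i \<Rightarrow> 'a) \<Rightarrow> real) \<Rightarrow> ('i \<Rightarrow> 'a) \<Rightarrow> real" where
  "coord_entropy M k g x =
     coord_expectation M k (\<lambda>z. g z * ln (g z)) x / coord_expectation M k g x
     - ln (coord_expectation M k g x)"

lemma coord_entropy_upd_same: "coord_entropy M k g (x(k := y)) = coord_entropy M k g x"
  by (simp add: coord_entropy_def coord_expectation_upd_same)

text \<open>Otherwise the simplifier turns \<open>{1..n}\<close> into \<open>{Suc 0..n}\<close>.\<close>
declare One_nat_def [simp del]

text \<open>Abstracts \<open>exp (\<beta> * f)\<close> to a function with values in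
  \<open>[a, b]\<close>, \<open>a > 0\<close>. The bounds pass to all iterated expectations, so
  logarithms and quotients stay bounded and integrability reduces to measurability.\<close>

locale positive_function_on_product = product_prob_space M "{1..n}"
  for M :: "nat \<Rightarrow> 'a measure" and n :: nat +
  fixes g :: "(nat \<Rightarrow> 'a) \<Rightarrow> real" and a b :: real
  assumes g_measurable [measurable]: "g \<in> borel_measurable (PiM {1..n} M)"
    and a_pos: "0 < a"
    and g_bounds: "\<And>x. x \<in> space (PiM {1..n} M) \<Longrightarrow> a \<le> g x \<and> g x \<le> b"
begin

definition L :: real where "L = \<bar>ln a\<bar> + \<bar>ln b\<bar>"

lemma g_ln_measurable: "(\<lambda>x. g x * ln (g x)) \<in> borel_measurable (PiM {1..n} M)" by measurable

lemma abs_mult_ln_le: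
  assumes "a \<le> y \<and> y \<le> b" "a \<le> z \<and> z \<le> b"
  shows "\<bar>y * ln z\<bar> \<le> b * L"
  unfolding abs_mult L_def using assms a_pos abs_ln_le[OF a_pos assms(2)] by (intro mult_mono) auto

lemma iterated_expectation_measurable [measurable]:
  "k \<le> n \<Longrightarrow> iterated_expectation M g k \<in> borel_measurable (PiM {1..n} M)"
  by (induction k) (auto intro: measurable_coord_expectation)

lemma iterated_expectation_bounds:
  "k \<le> n \<Longrightarrow> x \<in> space (PiM {1..n} M) \<Longrightarrow>
    a \<le> iterated_expectation M g k x \<and> iterated_expectation M g k x \<le> b"
proof (induction k arbitrary: x)
  case (Suc k)
  then show ?case
    using coord_expectation_bounds[of "iterated_expectation M g k" a b "Suc k" x] by simp
qed (simp add: g_bounds)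

lemma integral_iterated_expectation:
  "k \<le> n \<Longrightarrow> (\<integral>x. iterated_expectation M g k x \<partial>PiM {1..n} M) = (\<integral>x. g x \<partial>PiM {1..n} M)"
proof (induction k)
  case (Suc k)
  have "\<bar>iterated_expectation M g k x\<bar> \<le> b" if "x \<in> space (PiM {1..n} M)" for x
    using iterated_expectation_bounds[OF _ that, of k] Suc.prems a_pos by simp
  with Suc show ?case
    using integral_coord_expectation[of "Suc k" "iterated_expectation M g k" b] by simp
qed simp

text \<open>Points of the product agree outside \<open>{1..n}\<close>, where they are
  \<open>undefined\<close>, so the last stage is constant on the space. A constant equals its own
  integral, which the tower property identifies.\<close>

lemma iterated_expectation_total:
  assumes "x \<in> space (PiM {1..n} M)"
  shows "iterated_expectation M g n x = (\<integral>z. g z \<partial>PiM {1..n} M)"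
proof -
  have "iterated_expectation M g n z = iterated_expectation M g n x" if "z \<in> space (PiM {1..n} M)" for z
    using that assms by (intro iterated_expectation_cong) (auto simp: space_PiM PiE_iff extensional_def)
  then have "(\<integral>z. iterated_expectation M g n z \<partial>PiM {1..n} M)
      = (\<integral>z. iterated_expectation M g n x \<partial>PiM {1..n} M)"
    by (intro Bochner_Integration.integral_cong) auto
  then show ?thesis using integral_iterated_expectation[of n] by (simp add: P.prob_space)
qed

lemma coord_entropy_measurable:
  assumes "k \<in> {1..n}"
  shows "coord_entropy M k g \<in> borel_measurable (PiM {1..n} M)"
  unfolding coord_entropy_def[abs_def]
  using measurable_coord_expectation[OF g_measurable assms]
    measurable_coord_expectation[OF g_ln_measurable assms]
  by measurable

lemma coord_expectation_g_bounds:
  assumes "k \<in> {1..n}" "x \<in> space (PiM {1..n} M)"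
  shows "a \<le> coord_expectation M k g x \<and> coord_expectation M k g x \<le> b"
  by (rule coord_expectation_bounds[OF g_measurable g_bounds assms])

lemma abs_coord_entropy_le:
  assumes k: "k \<in> {1..n}" and x: "x \<in> space (PiM {1..n} M)"
  shows "\<bar>coord_entropy M k g x\<bar> \<le> b * L / a + L"
proof -
  note E = coord_expectation_g_bounds[OF k x]
  have "- (b * L) \<le> g z * ln (g z) \<and> g z * ln (g z) \<le> b * L" if "z \<in> space (PiM {1..n} M)" for z
    using abs_mult_ln_le[OF g_bounds[OF that] g_bounds[OF that]] by (simp add: abs_le_iff)
  from coord_expectation_bounds[OF g_ln_measurable this k x]
  have "\<bar>coord_expectation M k (\<lambda>z. g z * ln (g z)) x\<bar> \<le> b * L" by linarith
  then have "\<bar>coord_expectation M k (\<lambda>z. g z * ln (g z)) x / coord_expectation M k g x\<bar> \<le> b * L / a"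
    unfolding abs_divide using E a_pos by (intro frac_le) auto
  moreover have "\<bar>ln (coord_expectation M k g x)\<bar> \<le> L"
    unfolding L_def by (rule abs_ln_le[OF a_pos E])
  ultimately show ?thesis unfolding coord_entropy_def by linarith
qed

lemma integrable_bounded:
  fixes u :: "(nat \<Rightarrow> 'a) \<Rightarrow> real"
  assumes "u \<in> borel_measurable (PiM {1..n} M)" "\<And>x. x \<in> space (PiM {1..n} M) \<Longrightarrow> \<bar>u x\<bar> \<le> B"
  shows "integrable (PiM {1..n} M) u"
  using assms by (intro P.integrable_const_bound[where B = B]) auto

lemma abs_g_mult_ln_diff_le:
  assumes "k < n" "x \<in> space (PiM {1..n} M)"
  shows "\<bar>g x * (ln (iterated_expectation M g k x) - ln (iterated_expectation M g (Suc k) x))\<bar> \<le> 2 * (b * L)"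
  using abs_mult_ln_le[OF g_bounds iterated_expectation_bounds[of k]]
    abs_mult_ln_le[OF g_bounds iterated_expectation_bounds[of "Suc k"]] assms
  unfolding right_diff_distrib by fastforce

lemma integrable_g_mult_ln_diff:
  assumes "k < n"
  shows "integrable (PiM {1..n} M)
    (\<lambda>x. g x * (ln (iterated_expectation M g k x) - ln (iterated_expectation M g (Suc k) x)))"
proof (rule integrable_bounded[OF _ abs_g_mult_ln_diff_le])
  have [measurable]: "iterated_expectation M g k \<in> borel_measurable (PiM {1..n} M)"
    "iterated_expectation M g (Suc k) \<in> borel_measurable (PiM {1..n} M)"
    using assms by (auto intro!: iterated_expectation_measurable simp del: iterated_expectation.simps)
  show "(\<lambda>x. g x * (ln (iterated_expectation M g k x) - ln (iterated_expectation M g (Suc k) x)))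
    \<in> borel_measurable (PiM {1..n} M)"
    by measurable
qed (use assms in auto)

lemma abs_g_mult_coord_entropy_le:
  assumes "k \<in> {1..n}" "x \<in> space (PiM {1..n} M)"
  shows "\<bar>g x * coord_entropy M k g x\<bar> \<le> b * (b * L / a + L)"
  unfolding abs_mult using g_bounds[OF assms(2)] a_pos
  by (intro mult_mono abs_coord_entropy_le assms) auto

lemma g_mult_coord_entropy_measurable:
  assumes "k \<in> {1..n}"
  shows "(\<lambda>x. g x * coord_entropy M k g x) \<in> borel_measurable (PiM {1..n} M)"
  using coord_entropy_measurable[OF assms] by measurable

text \<open>Gibbs' inequality on the fibre through \<open>x\<close>, with stage \<open>k\<close> as
  trial function: its mean over the fibre is stage \<open>Suc k\<close>.\<close>

lemma coord_expectation_mult_ln_diff_le: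
  assumes k: "k < n" and x: "x \<in> space (PiM {1..n} M)"
  shows "coord_expectation M (Suc k)
      (\<lambda>z. g z * (ln (iterated_expectation M g k z) - ln (iterated_expectation M g (Suc k) z))) x
    \<le> coord_expectation M (Suc k) (\<lambda>z. g z * coord_entropy M (Suc k) g z) x"
proof -
  have k': "Suc k \<in> {1..n}" using k by simp
  let ?x = "\<lambda>y. x(Suc k := y)"
  let ?P = "M (Suc k)"
  have in_space: "?x y \<in> space (PiM {1..n} M)" if "y \<in> space ?P" for y
    by (rule fun_upd_in_space_PiM[OF x k' that])
  have "coord_expectation M (Suc k)
      (\<lambda>z. g z * (ln (iterated_expectation M g k z) - ln (iterated_expectation M g (Suc k) z))) x
    = (\<integral>y. g (?x y) * (ln (iterated_expectation M g k (?x y))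
        - ln (\<integral>y. iterated_expectation M g k (?x y) \<partial>?P)) \<partial>?P)"
    by (simp add: coord_expectation_def)
  also have "\<dots> \<le> (\<integral>y. g (?x y) * ln (g (?x y)) \<partial>?P) - (\<integral>y. g (?x y) \<partial>?P) * ln (\<integral>y. g (?x y) \<partial>?P)"
  proof (rule M.entropy_variational[OF _ _ a_pos])
    show "(\<lambda>y. g (?x y)) \<in> borel_measurable ?P" by (rule measurable_section[OF g_measurable k' x])
    show "(\<lambda>y. iterated_expectation M g k (?x y)) \<in> borel_measurable ?P"
      using k by (intro measurable_section k' x iterated_expectation_measurable) auto
  qed (use g_bounds iterated_expectation_bounds[of k] k in_space in auto)
  also have "\<dots> = coord_expectation M (Suc k) g x * coord_entropy M (Suc k) g x"
    using coord_expectation_g_bounds[OF k' x] a_pos unfolding coord_entropy_def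
    by (simp add: field_simps) (simp add: coord_expectation_def)
  \<comment> \<open>The conditional entropy is constant along the fibre and can be moved under the
    fibre integral.\<close>
  also have "\<dots> = coord_expectation M (Suc k) (\<lambda>z. g z * coord_entropy M (Suc k) g z) x"
    by (simp add: coord_expectation_def[of _ _ g] coord_expectation_def[of _ _ "\<lambda>z. g z * coord_entropy M (Suc k) g z"]
        coord_entropy_upd_same)
  finally show ?thesis .
qed

text \<open>The fibrewise inequality is integrated over the product; the tower property removes the
  conditional expectation from both sides.\<close>

lemma integral_mult_ln_diff_le:
  assumes k: "k < n"
  shows "(\<integral>x. g x * (ln (iterated_expectation M g k x) - ln (iterated_expectation M g (Suc k) x)) \<partial>PiM {1..n} M)
    \<le> (\<integral>x. g x * coord_entropy M (Suc k) g x \<partial>PiM {1..n} M)"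
    (is "integral\<^sup>L _ ?l \<le> integral\<^sup>L _ ?r")
proof -
  have k': "Suc k \<in> {1..n}" using k by simp
  note l = borel_measurable_integrable[OF integrable_g_mult_ln_diff[OF k]] abs_g_mult_ln_diff_le[OF k]
  note r = g_mult_coord_entropy_measurable[OF k'] abs_g_mult_coord_entropy_le[OF k']
  have int: "integrable (PiM {1..n} M) (coord_expectation M (Suc k) u)"
    if u: "u \<in> borel_measurable (PiM {1..n} M)" "\<And>x. x \<in> space (PiM {1..n} M) \<Longrightarrow> \<bar>u x\<bar> \<le> B" for u B
  proof (rule integrable_bounded[OF measurable_coord_expectation[OF u(1) k']])
    fix x assume x: "x \<in> space (PiM {1..n} M)"
    have "- B \<le> u z \<and> u z \<le> B" if "z \<in> space (PiM {1..n} M)" for z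
      using u(2)[OF that] by linarith
    from coord_expectation_bounds[OF u(1) this k' x]
    show "\<bar>coord_expectation M (Suc k) u x\<bar> \<le> B" by linarith
  qed
  have "integral\<^sup>L (PiM {1..n} M) ?l = (\<integral>x. coord_expectation M (Suc k) ?l x \<partial>PiM {1..n} M)"
    by (rule integral_coord_expectation[OF _ k' l, symmetric]) auto
  also have "\<dots> \<le> (\<integral>x. coord_expectation M (Suc k) ?r x \<partial>PiM {1..n} M)"
    by (intro integral_mono int[OF l] int[OF r] coord_expectation_mult_ln_diff_le[OF k])
  also have "\<dots> = integral\<^sup>L (PiM {1..n} M) ?r"
    by (rule integral_coord_expectation[OF _ k' r]) auto
  finally show ?thesis .
qed

theorem entropy_subadditive:
  "(\<integral>x. g x * (ln (g x) - ln (\<integral>z. g z \<partial>PiM {1..n} M)) \<partial>PiM {1..n} M)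
    \<le> (\<integral>x. g x * (\<Sum>k = 1..n. coord_entropy M k g x) \<partial>PiM {1..n} M)"
proof -
  let ?G = "iterated_expectation M g"
  have "(\<integral>x. g x * (ln (g x) - ln (\<integral>z. g z \<partial>PiM {1..n} M)) \<partial>PiM {1..n} M)
      = (\<integral>x. (\<Sum>k<n. g x * (ln (?G k x) - ln (?G (Suc k) x))) \<partial>PiM {1..n} M)"
  proof (intro Bochner_Integration.integral_cong refl)
    fix x assume "x \<in> space (PiM {1..n} M)"
    \<comment> \<open>The telescope runs from stage \<open>0\<close>, which is \<open>g\<close>, to
      stage \<open>n\<close>, which is the constant mean of \<open>g\<close>.\<close>
    then have "ln (g x) - ln (\<integral>z. g z \<partial>PiM {1..n} M) = (\<Sum>k<n. ln (?G k x) - ln (?G (Suc k) x))"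
      unfolding sum_lessThan_telescope'[of "\<lambda>k. ln (?G k x)" n]
      by (simp add: iterated_expectation_total)
    then show "g x * (ln (g x) - ln (\<integral>z. g z \<partial>PiM {1..n} M))
        = (\<Sum>k<n. g x * (ln (?G k x) - ln (?G (Suc k) x)))"
      by (simp only: sum_distrib_left)
  qed
  also have "\<dots> = (\<Sum>k<n. \<integral>x. g x * (ln (?G k x) - ln (?G (Suc k) x)) \<partial>PiM {1..n} M)"
    by (intro Bochner_Integration.integral_sum integrable_g_mult_ln_diff) auto
  also have "\<dots> \<le> (\<Sum>k<n. \<integral>x. g x * coord_entropy M (Suc k) g x \<partial>PiM {1..n} M)"
    by (intro sum_mono integral_mult_ln_diff_le) auto
  also have "\<dots> = (\<Sum>k = 1..n. \<integral>x. g x * coord_entropy M k g x \<partial>PiM {1..n} M)"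
    by (rule sum.reindex_bij_witness[of _ "\<lambda>k. k - 1" Suc]) auto
  also have "\<dots> = (\<integral>x. (\<Sum>k = 1..n. g x * coord_entropy M k g x) \<partial>PiM {1..n} M)"
    by (intro Bochner_Integration.integral_sum[symmetric]
        integrable_bounded[OF g_mult_coord_entropy_measurable abs_g_mult_coord_entropy_le])
  finally show ?thesis by (simp add: sum_distrib_left)
qed

end

section \<open>From fibres to the product space\<close>

text \<open>Of two updates at \<open>k\<close> only the later survives, so the subtracted mean is
  the same constant all along the fibre, and what remains is the thermal variance of a section of
  \<open>f\<close>.\<close>

lemma coord_thermal_variance_eq:
  "coord_thermal_variance M k s f f x =
    thermal_expectation (M k) s (\<lambda>y. f (x(k := y)))
      (\<lambda>y. (f (x(k := y)) - thermal_expectation (M k) s (\<lambda>y. f (x(k := y))) (\<lambda>y. f (x(k := y))))\<^sup>2)"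
  by (simp add: coord_thermal_variance_def coord_thermal_expectation_def thermal_expectation_def
      coord_expectation_def)

text \<open>For \<open>g = exp (s * f)\<close> one has \<open>g * ln g = s * f * g\<close>, so the
  quotient in \<open>coord_entropy\<close> is \<open>s\<close> times the thermal mean of the
  section.\<close>

lemma coord_entropy_exp:
  "coord_entropy M k (\<lambda>z. exp (s * f z)) x = canonical_entropy (M k) (\<lambda>y. f (x(k := y))) s"
proof -
  have "(\<integral>y. exp (s * f (x(k := y))) * (s * f (x(k := y))) \<partial>M k)
      = (\<integral>y. s * (f (x(k := y)) * exp (s * f (x(k := y)))) \<partial>M k)"
    by (simp add: mult_ac)
  then show ?thesis
    by (simp add: coord_entropy_def canonical_entropy_def thermal_expectation_def coord_expectation_def)
qed

lemma (in product_prob_space) coord_entropy_eq_double_integral: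
  assumes "f \<in> borel_measurable (PiM I M)" "\<And>x. x \<in> space (PiM I M) \<Longrightarrow> \<bar>f x\<bar> \<le> C"
    and "k \<in> I" "x \<in> space (PiM I M)" "0 < \<beta>"
  shows "(LBINT t=0..\<beta>. (LBINT s=t..\<beta>. coord_thermal_variance M k s f f x))
    = coord_entropy M k (\<lambda>z. exp (\<beta> * f z)) x"
proof -
  interpret fibre: bounded_rv "M k" "\<lambda>y. f (x(k := y))" C
    using assms by unfold_locales (auto intro!: measurable_section fun_upd_in_space_PiM)
  show ?thesis
    unfolding coord_thermal_variance_eq coord_entropy_exp
    by (rule fibre.entropy_eq_double_integral[OF assms(5)])
qed

theorem theorem7:
  fixes n :: nat
    and M :: "nat \<Rightarrow> 'a measure"
    and f :: "(nat \<Rightarrow> 'a) \<Rightarrow> real"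
    and \<beta> :: real
  assumes "\<And>k. k \<in> {1..n} \<Longrightarrow> prob_space (M k)"
    and "f \<in> borel_measurable (PiM {1..n} M)"
    and "bounded (f ` space (PiM {1..n} M))"
    and "\<beta> > 0"
  shows "canonical_entropy (PiM {1..n} M) f \<beta> \<le>
           thermal_expectation (PiM {1..n} M) \<beta> f
             (\<lambda>x. \<Sum>k = 1..n. (LBINT t=0..\<beta>. (LBINT s=t..\<beta>. coord_thermal_variance M k s f f x)))
       \<and> ln (\<integral>x. exp (\<beta> * (f x - (\<integral>z. f z \<partial>(PiM {1..n} M)))) \<partial>(PiM {1..n} M)) =
           \<beta> * (LBINT \<gamma>=0..\<beta>. canonical_entropy (PiM {1..n} M) f \<gamma> / \<gamma>\<^sup>2)
       \<and> (\<forall>t\<ge>0. measure (PiM {1..n} M)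
                   {x \<in> space (PiM {1..n} M). f x - (\<integral>z. f z \<partial>(PiM {1..n} M)) > t}
                 \<le> exp (\<beta> * (LBINT \<gamma>=0..\<beta>. canonical_entropy (PiM {1..n} M) f \<gamma> / \<gamma>\<^sup>2) - \<beta> * t))"
proof -
  \<comment> \<open>The measure at an index outside \<open>{1..n}\<close> is arbitrary, but \<^locale>\<open>product_prob_space\<close>
    wants a probability measure at every index.\<close>
  define N where "N k = (if k \<in> {1..n} then M k else return (count_space UNIV) undefined)" for k
  have N: "prob_space (N k)" for k
    using assms(1) by (auto simp: N_def intro: prob_space_return)
  have PiM_N: "PiM {1..n} N = PiM {1..n} M" by (rule PiM_cong) (auto simp: N_def)
  have variance_N: "coord_thermal_variance N k s f f x = coord_thermal_variance M k s f f x"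
    if "k \<in> {1..n}" for k s x
    using that unfolding coord_thermal_variance_eq by (simp add: N_def)
  interpret product_prob_space N "{1..n}"
    using N by (simp add: product_prob_space_def product_prob_space_axioms_def product_sigma_finite_def
        prob_space_imp_sigma_finite)
  obtain C where C: "\<And>x. x \<in> space (PiM {1..n} M) \<Longrightarrow> \<bar>f x\<bar> \<le> C"
    using assms(3) by (auto simp: bounded_iff)
  interpret bounded_rv "PiM {1..n} M" f C
    using P.prob_space_axioms assms(2) C by (simp add: bounded_rv_def bounded_rv_axioms_def PiM_N)
  let ?g = "\<lambda>x. exp (\<beta> * f x)"
  interpret positive_function_on_product N n ?g "exp (- (\<bar>\<beta>\<bar> * C))" "exp (\<bar>\<beta>\<bar> * C)"
    by unfold_locales (use exp_h_bounds[of _ \<beta>] in \<open>auto simp: PiM_N\<close>)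
  \<comment> \<open>The entropy bound is proved multiplied by the partition function; the final
    division turns the weighted integral back into a thermal expectation.\<close>
  have "canonical_entropy (PiM {1..n} M) f \<beta> * partition_function \<beta>
      = (\<integral>x. ?g x * (ln (?g x) - ln (partition_function \<beta>)) \<partial>PiM {1..n} M)"
  proof -
    \<comment> \<open>Integrability of \<open>g * ln g\<close> for \<open>g = ?g\<close>, needed to
      split the integral of the difference of logarithms.\<close>
    have "integrable (PiM {1..n} M) (\<lambda>x. \<beta> * (f x * ?g x))"
      by (intro integrable_mult_right integrable_mult_exp[OF _ abs_h_le]) auto
    then show ?thesis
      unfolding canonical_entropy_eq by (simp add: right_diff_distrib mult_ac)
  qed
  also have "\<dots> \<le> (\<integral>x. ?g x * (\<Sum>k = 1..n. coord_entropy N k ?g x) \<partial>PiM {1..n} M)"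
    using entropy_subadditive unfolding PiM_N .
  also have "\<dots> = (\<integral>x. (\<Sum>k = 1..n. (LBINT t=0..\<beta>. (LBINT s=t..\<beta>. coord_thermal_variance M k s f f x)))
      * ?g x \<partial>PiM {1..n} M)"
  proof (intro Bochner_Integration.integral_cong refl)
    fix x assume "x \<in> space (PiM {1..n} M)"
    \<comment> \<open>Each fibre entropy becomes the double integral of the conditional variance;
      \<open>variance_N\<close> returns from \<open>N\<close> to \<open>M\<close>.\<close>
    then have "coord_entropy N k ?g x
        = (LBINT t=0..\<beta>. (LBINT s=t..\<beta>. coord_thermal_variance M k s f f x))" if "k \<in> {1..n}" for k
      using coord_entropy_eq_double_integral[of f C k x \<beta>] assms(2,4) C that
      by (simp add: PiM_N variance_N)
    then show "?g x * (\<Sum>k = 1..n. coord_entropy N k ?g x) =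
        (\<Sum>k = 1..n. (LBINT t=0..\<beta>. (LBINT s=t..\<beta>. coord_thermal_variance M k s f f x))) * ?g x"
      by (simp add: mult.commute)
  qed
  finally have "canonical_entropy (PiM {1..n} M) f \<beta> \<le>
      thermal_expectation (PiM {1..n} M) \<beta> f
        (\<lambda>x. \<Sum>k = 1..n. (LBINT t=0..\<beta>. (LBINT s=t..\<beta>. coord_thermal_variance M k s f f x)))"
    unfolding thermal_expectation_def using integral_exp_pos[of \<beta>] by (simp add: pos_le_divide_eq)
  then show ?thesis
    using log_laplace_transform[OF assms(4)] chernoff_bound[OF assms(4)] by blast
qed

end
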